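(* Let $H_i$ be an $M$-object hypothesis and let $H_{ij}$ be its children in the birth and death model. Then the update equation for the joint density of multi-object state and hypothesis is $$p(\{X\},(i,j)/\mathcal{F}^t)=\frac{p(\{Z_t\}/\{X\},(i,j))\,p^-(\{X\}/(i,j),\mathcal{F}^{t-1})}{\int p(\{Z_t\}/\{X'\},(i,j))\,p^-(\{X'\}/(i,j),\mathcal{F}^{t-1})\,d\{X'\}}\cdot\frac{l_{ij}\,w_{ij}}{\sum_{i',j'}l_{i'j'}\,w_{i'j'}},\qquad w_{ij}=p_{ij}w_i,$$ where $$l_{ij}=\int p(\{Z_t\}/\{X'\},(i,j))\,p^-(\{X'\}/(i,j),\mathcal{F}^{t-1})\,d\{X'\},$$ the transition probabilities are $$p_{ij}=\begin{cases}\alpha\,p^k_{M+1}, & j\in B_{M+1,k},\\ (1-M_t^b\alpha-M_t^d\beta)\,p^k_M, & j\in B_{M,k},\\ \beta\,p^k_{M-1}, & j\in B_{M-1,k},\end{cases}\qquad p_n^k=\frac{p_D^k(1-p_D)^{n-k}}{\binom{m}{k}k!},$$ and the predicted prior $p^-(\{X\}/(i,j),\mathcal{F}^{t-1})$ is given by: (a) $\prod_{k\neq d}p_k^-(x_k)$ if $H_{ij}$ is a death hypothesis in which object $d$ dies; (b) $\Big[\prod_{k=1}^M p_k^-(x_k)\Big]\,p_b^l(x_{M+1})$ if $H_{ij}$ is a birth hypothesis in which the new object has birth pdf $p_b^l$; (c) $\prod_{k=1}^M p_k^-(x_k)$ if $H_{ij}$ is a no birth or death hypothesis. Here $p_k^-(x_k)=\int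 p_k(x_k/x_k')p_k(x_k')\,dx_k'$ is the predicted pdf of object $k$.
   Context: Multi-object tracking in which objects have states in $\mathbb{R}^N$ and the number of objects may change. $\mathcal{F}^{t-1}$ is the data up to time $t-1$, $\{Z_t\}=\{z_1,\dots,z_m\}$ are the $m$ measurements at time $t$, and $\mathcal{F}^t$ adds $\{Z_t\}$ to $\mathcal{F}^{t-1}$. Notation: "$a/b$" inside $p(\cdot)$ means $a$ conditioned on $b$. A finite family of hypotheses $H_i$ is given at time $t-1$; $w_i=p(i/\mathcal{F}^{t-1})$ is the probability of $H_i$. A hypothesis fixes the number of objects; if $H_i$ is an $M$-object hypothesis ($M$ may depend on $i$), its multi-object pdf is $p(\{X\}/i,\mathcal{F}^{t-1})=\prod_{k=1}^M p_k(x_k)$, with labelled components $p_k$ depending on $i$ (suppressed), and the joint density is $p(\{X\},i/\mathcal{F}^{t-1})=w_i\,p(\{X\}/i,\mathcal{F}^{t-1})$. Birth and death model: $\alpha$ is the probability of a new object being spawned and $\beta$ the probability of an object dying between two measurements; at most one birth or one death (not both) occurs between measurements. There are $M_t^b$ possible births, the $l$-th one ($1\le l\le M_t^b$) adding an object numbered $M+1$ with birth pdf $p_b^l$, each having probability $\alpha$; there are $M_t^d$ possible deaths, corresponding to $M_t^d$ of the objects of $H_i$, each having probability $\beta$; no birth or death occurs with probability $1-M_t^b\alpha-M_t^d\beta$. Children: a child $H_{ij}$ of $H_i$ consists of one of these birth/death/no-change outcomes, giving $n\in\{M+1,M-1,M\}$ objects, together with a data association of the $m$ measurements with the resulting $n$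 objects: each measurement $z_k$ is assigned to $X_{j_k}$, which is an object or clutter, with each object assigned to at most one measurement. $B_{n,k}$ denotes the set of all $n$-object (child) hypotheses in which exactly $k$ of the objects are associated to measurements. $p_D$ is the probability of detection. The quantity $p_{ij}$ is the transition probability from $H_i$ to $H_{ij}$, independent of the continuous state. Transition densities of the multi-object state underlying $H_{ij}$: surviving objects move independently with densities $p_k(x_k/x_k')$. Thus $p(\{X\}/\{X'\},(i,j))$ equals $\prod_{k=1}^M p_k(x_k/x'_k)$ in the no birth or death case; $\big[\prod_{k\ne d}p_k(x_k/x_k')\big]\delta(\phi/x'_d)$ if object $d$ dies, where $\delta(\phi/x'_d)$ expresses that object $d$ becomes the null object $\phi$ with probability one; and $\big[\prod_{k=1}^M p_k(x_k/x_k')\big]p_{M+1}(x_{M+1}/\phi)$ with $p_{M+1}(x_{M+1}/\phi)=p_b^l(x_{M+1})$ in the case of the $l$-th birth. The predicted prior is $$p^-(\{X\}/(i,j),\mathcal{F}^{t-1})=\int p(\{X\}/(i,j),\{X'\})\,p(\{X'\}/i,\mathcal{F}^{t-1})\,d\{X'\},$$ and the predicted joint density is $p^-(\{X\},(i,j)/\mathcal{F}^{t-1})=p^-(\{X\}/(i,j),\mathcal{F}^{t-1})\,p_{ij}\,w_i$. Measurement model: $p(z/X_k=x)$ is the single-object observation likelihood and $g(z)$ the probability (density) that $z$ arises from clutter. The multi-object likelihood is $$p(\{Z_t\}/\{X\},(i,j))=\prod_{k:\,X_{j_k}\text{ an object}}p(z_k/X_{j_k}=x_{j_k})\prod_{k:\,X_{j_k}\text{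 clutter}}g(z_k).$$ Update: the posterior joint density is defined by Bayes' rule, $$p(\{X\},(i,j)/\mathcal{F}^t)=\frac{p(\{Z_t\}/\{X\},(i,j))\,p^-(\{X\},(i,j)/\mathcal{F}^{t-1})}{\sum_{i',j'}\int p(\{Z_t\}/\{X'\},(i',j'))\,p^-(\{X'\},(i',j')/\mathcal{F}^{t-1})\,d\{X'\}}.$$ All normalizing denominators are taken to be positive. *)

theory Defs
  imports "HOL-Probability.Probability" "HOL-Probability.Product_PMF"
begin

text \<open>
  Objects of a hypothesis \<open>i\<close> are labelled \<open>1..M\<close>; a newborn object gets the label \<open>M + 1\<close>, and
  after the death of object \<open>d\<close> the survivors keep their labels.  A multi-object state is a partial
  map from labels to states, \<open>None\<close> playing the role of the null object.
  The field \<open>dying i\<close> is the set of objects of hypothesis \<open>i\<close> that may die, so the number of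
  possible deaths is its cardinality.  In \<open>trans_pdf i k x x'\<close> the conditioning (previous) state
  is the last argument.
\<close>

record ('h, 'n, 'z) tracking_model =
  hyps :: "'h set"
  weight :: "'h \<Rightarrow> real"
  num_objs :: "'h \<Rightarrow> nat"
  obj_pdf :: "'h \<Rightarrow> nat \<Rightarrow> real ^ 'n \<Rightarrow> real"
  trans_pdf :: "'h \<Rightarrow> nat \<Rightarrow> real ^ 'n \<Rightarrow> real ^ 'n \<Rightarrow> real"
  num_births :: nat
  birth_pdf :: "nat \<Rightarrow> real ^ 'n \<Rightarrow> real"
  dying :: "'h \<Rightarrow> nat set"
  birth_prob :: real
  death_prob :: real
  detect_prob :: real
  num_meas :: nat
  meas :: "nat \<Rightarrow> 'z"
  obs_lik :: "nat \<Rightarrow> 'z \<Rightarrow> real ^ 'n \<Rightarrow> real"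
  clutter :: "'z \<Rightarrow> real"

definition is_pdf :: "(real ^ 'n::finite \<Rightarrow> real) \<Rightarrow> bool" where
  "is_pdf f \<longleftrightarrow> (\<forall>x. 0 \<le> f x) \<and> integrable lborel f \<and> (\<integral>x. f x \<partial>lborel) = 1"

definition no_change_prob :: "('h, 'n::finite, 'z) tracking_model \<Rightarrow> 'h \<Rightarrow> real" where
  "no_change_prob T i =
     1 - real (num_births T) * birth_prob T - real (card (dying T i)) * death_prob T"

definition valid_model :: "('h, 'n::finite, 'z) tracking_model \<Rightarrow> bool" where
  "valid_model T \<longleftrightarrow>
     finite (hyps T) \<and> (\<forall>i\<in>hyps T. 0 \<le> weight T i) \<and> (\<Sum>i\<in>hyps T. weight T i) = 1 \<and>
     (\<forall>i\<in>hyps T. \<forall>k\<in>{1..num_objs T i}. is_pdf (obj_pdf T i k)) \<and>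
     (\<forall>i\<in>hyps T. \<forall>k\<in>{1..num_objs T i}.
        (\<lambda>(x, x'). trans_pdf T i k x x') \<in> borel_measurable (borel \<Otimes>\<^sub>M borel) \<and>
        (\<forall>x'. is_pdf (\<lambda>x. trans_pdf T i k x x'))) \<and>
     (\<forall>l\<in>{1..num_births T}. is_pdf (birth_pdf T l)) \<and>
     (\<forall>i\<in>hyps T. dying T i \<subseteq> {1..num_objs T i}) \<and>
     0 \<le> birth_prob T \<and> 0 \<le> death_prob T \<and> (\<forall>i\<in>hyps T. 0 \<le> no_change_prob T i) \<and>
     0 \<le> detect_prob T \<and> detect_prob T \<le> 1 \<and>
     (\<forall>k z. obs_lik T k z \<in> borel_measurable borel \<and> (\<forall>x. 0 \<le> obs_lik T k z x)) \<and>
     (\<forall>z. 0 \<le> clutter T z)"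

datatype outcome = Birth nat | Death nat | No_Change

text \<open>A data association sends the index of a measurement to the label of its object, or to
  \<open>None\<close> if the measurement is clutter.\<close>

type_synonym child = "outcome \<times> (nat \<rightharpoonup> nat)"

definition outcomes :: "('h, 'n::finite, 'z) tracking_model \<Rightarrow> 'h \<Rightarrow> outcome set" where
  "outcomes T i = Birth ` {1..num_births T} \<union> Death ` dying T i \<union> {No_Change}"

fun objects_after :: "nat \<Rightarrow> outcome \<Rightarrow> nat set" where
  "objects_after M (Birth l) = {1..M + 1}"
| "objects_after M (Death d) = {1..M} - {d}"
| "objects_after M No_Change = {1..M}"

definition associations :: "nat \<Rightarrow> nat set \<Rightarrow> (nat \<rightharpoonup> nat) set" where
  "associations m A = {a. dom a \<subseteq> {1..m} \<and> ran a \<subseteq> A \<and> inj_on a (dom a)}"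

definition objects :: "('h, 'n::finite, 'z) tracking_model \<Rightarrow> 'h \<Rightarrow> child \<Rightarrow> nat set" where
  "objects T i j = objects_after (num_objs T i) (fst j)"

definition children :: "('h, 'n::finite, 'z) tracking_model \<Rightarrow> 'h \<Rightarrow> child set" where
  "children T i = {j. fst j \<in> outcomes T i \<and> snd j \<in> associations (num_meas T) (objects T i j)}"

definition B_hyps :: "('h, 'n::finite, 'z) tracking_model \<Rightarrow> 'h \<Rightarrow> nat \<Rightarrow> nat \<Rightarrow> child set" where
  "B_hyps T i n k = {j \<in> children T i. card (objects T i j) = n \<and> card (ran (snd j)) = k}"

definition outcome_pmf :: "('h, 'n::finite, 'z) tracking_model \<Rightarrow> 'h \<Rightarrow> outcome pmf" where
  "outcome_pmf T i = embed_pmf (\<lambda>c. if c \<in> outcomes T i then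
       (case c of Birth l \<Rightarrow> birth_prob T | Death d \<Rightarrow> death_prob T
          | No_Change \<Rightarrow> no_change_prob T i) else 0)"

definition detected_pmf :: "real \<Rightarrow> nat set \<Rightarrow> nat set pmf" where
  "detected_pmf pD A = map_pmf (\<lambda>f. {k. f k}) (Pi_pmf A False (\<lambda>_. bernoulli_pmf pD))"

text \<open>Random generation of a child: a birth/death outcome occurs, each resulting object is detected
  independently, and, given the set \<open>D\<close> of detected objects, all ways of matching the objects in
  \<open>D\<close> with distinct measurements are equally likely.  If more objects are detected than there are
  measurements no association exists, and the result is \<open>None\<close>.\<close>

definition child_pmf :: "('h, 'n::finite, 'z) tracking_model \<Rightarrow> 'h \<Rightarrow> child option pmf" where
  "child_pmf T i =
     bind_pmf (outcome_pmf T i) (\<lambda>c.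
     bind_pmf (detected_pmf (detect_prob T) (objects_after (num_objs T i) c)) (\<lambda>D.
       let S = {a \<in> associations (num_meas T) D. ran a = D} in
       if S = {} then return_pmf None else map_pmf (\<lambda>a. Some (c, a)) (pmf_of_set S)))"

definition child_prob :: "('h, 'n::finite, 'z) tracking_model \<Rightarrow> 'h \<Rightarrow> child \<Rightarrow> real" where
  "child_prob T i j = pmf (child_pmf T i) (Some j)"

definition child_weight :: "('h, 'n::finite, 'z) tracking_model \<Rightarrow> 'h \<Rightarrow> child \<Rightarrow> real" where
  "child_weight T i j = child_prob T i j * weight T i"

text \<open>Integral over all multi-object states whose set of object labels is \<open>A\<close>.\<close>

definition state_integral :: "nat set \<Rightarrow> ((nat \<rightharpoonup> real ^ 'n::finite) \<Rightarrow> real) \<Rightarrow> real" where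
  "state_integral A f =
     (\<integral>x. f (\<lambda>k. if k \<in> A then Some (x k) else None) \<partial>(Pi\<^sub>M A (\<lambda>_. lborel)))"

definition prior_pdf ::
  "('h, 'n::finite, 'z) tracking_model \<Rightarrow> 'h \<Rightarrow> (nat \<rightharpoonup> real ^ 'n) \<Rightarrow> real" where
  "prior_pdf T i X = (\<Prod>k=1..num_objs T i. obj_pdf T i k (the (X k)))"

text \<open>The conditional probability mass function of an object that dies with probability one.\<close>

definition null_mass :: "'a option \<Rightarrow> 'a option \<Rightarrow> real" where
  "null_mass y y' = (if y = None then 1 else 0)"

definition multi_trans_pdf ::
  "('h, 'n::finite, 'z) tracking_model \<Rightarrow> 'h \<Rightarrow> child \<Rightarrow>
     (nat \<rightharpoonup> real ^ 'n) \<Rightarrow> (nat \<rightharpoonup> real ^ 'n) \<Rightarrow> real" where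
  "multi_trans_pdf T i j X X' =
     (let M = num_objs T i; p = (\<lambda>k. trans_pdf T i k (the (X k)) (the (X' k))) in
      case fst j of
        Birth l \<Rightarrow> (\<Prod>k=1..M. p k) * birth_pdf T l (the (X (M + 1)))
      | Death d \<Rightarrow> (\<Prod>k\<in>{1..M} - {d}. p k) * null_mass (X d) (X' d)
      | No_Change \<Rightarrow> (\<Prod>k=1..M. p k))"

definition pred_prior ::
  "('h, 'n::finite, 'z) tracking_model \<Rightarrow> 'h \<Rightarrow> child \<Rightarrow> (nat \<rightharpoonup> real ^ 'n) \<Rightarrow> real" where
  "pred_prior T i j X =
     state_integral {1..num_objs T i} (\<lambda>X'. multi_trans_pdf T i j X X' * prior_pdf T i X')"

definition pred_joint ::
  "('h, 'n::finite, 'z) tracking_model \<Rightarrow> 'h \<Rightarrow> child \<Rightarrow> (nat \<rightharpoonup> real ^ 'n) \<Rightarrow> real" where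
  "pred_joint T i j X = pred_prior T i j X * child_prob T i j * weight T i"

definition pred_obj_pdf ::
  "('h, 'n::finite, 'z) tracking_model \<Rightarrow> 'h \<Rightarrow> nat \<Rightarrow> real ^ 'n \<Rightarrow> real" where
  "pred_obj_pdf T i k x = (\<integral>x'. trans_pdf T i k x x' * obj_pdf T i k x' \<partial>lborel)"

definition likelihood ::
  "('h, 'n::finite, 'z) tracking_model \<Rightarrow> child \<Rightarrow> (nat \<rightharpoonup> real ^ 'n) \<Rightarrow> real" where
  "likelihood T j X =
     (\<Prod>k\<in>{k \<in> {1..num_meas T}. snd j k \<noteq> None}.
        obs_lik T (the (snd j k)) (meas T k) (the (X (the (snd j k))))) *
     (\<Prod>k\<in>{k \<in> {1..num_meas T}. snd j k = None}. clutter T (meas T k))"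

definition child_lik :: "('h, 'n::finite, 'z) tracking_model \<Rightarrow> 'h \<Rightarrow> child \<Rightarrow> real" where
  "child_lik T i j = state_integral (objects T i j) (\<lambda>X'. likelihood T j X' * pred_prior T i j X')"

definition bayes_denom :: "('h, 'n::finite, 'z) tracking_model \<Rightarrow> real" where
  "bayes_denom T = (\<Sum>(i, j)\<in>(SIGMA i:hyps T. children T i).
     state_integral (objects T i j) (\<lambda>X'. likelihood T j X' * pred_joint T i j X'))"

definition posterior ::
  "('h, 'n::finite, 'z) tracking_model \<Rightarrow> 'h \<Rightarrow> child \<Rightarrow> (nat \<rightharpoonup> real ^ 'n) \<Rightarrow> real" where
  "posterior T i j X = likelihood T j X * pred_joint T i j X / bayes_denom T"

definition assoc_prob :: "real \<Rightarrow> nat \<Rightarrow> nat \<Rightarrow> nat \<Rightarrow> real" where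
  "assoc_prob pD m n k = pD ^ k * (1 - pD) ^ (n - k) / (real (m choose k) * fact k)"

end

theory Submission
  imports Defs
begin

text \<open>
  A child determines the outcome and the set \<open>D\<close> of detected objects that generated it, so its
  probability is a product of three factors: that of the outcome, that of \<open>D\<close>, and the uniform weight
  of one of the \<open>(m choose k) * k!\<close> injective matchings of the \<open>k\<close> objects in \<open>D\<close> with measurements.
  The predicted prior factorizes by Fubini, and the update equation is Bayes' rule with the common
  factor \<open>child_lik T i j\<close> inserted.
\<close>

section \<open>Counting injective matchings\<close>

text \<open>Induction on \<open>k\<close> by the absorption identity for binomials. For
  \<open>k > m\<close> both sides are 0, the left one because it contains the factor
  \<open>m - m\<close>.\<close>

lemma prod_falling_eq_choose_fact: "(\<Prod>i = 0..<k. m - i) = (m choose k) * fact k" for m k :: nat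
proof (induction k)
  case (Suc k)
  have "(m choose Suc k) * Suc k = (m - k) * (m choose k)"
    by (metis binomial_absorb_comp binomial_absorption mult.commute)
  then show ?case
    using Suc by (simp del: binomial_Suc_Suc) (metis mult.assoc mult.commute mult_Suc)
qed simp

text \<open>Transposing the graph of a matching gives a bijection onto the injections from
  \<open>D\<close> into \<open>B\<close>, whose number is a falling factorial.\<close>

lemma card_injective_maps_onto:
  fixes B :: "'a set" and D :: "'b set"
  assumes "finite B" "finite D"
  shows "card {a. dom a \<subseteq> B \<and> ran a = D \<and> inj_on a (dom a)} =
    (card B choose card D) * fact (card D)"
proof -
  let ?S = "{a. dom a \<subseteq> B \<and> ran a = D \<and> inj_on a (dom a)}"
  let ?F = "{f \<in> D \<rightarrow>\<^sub>E B. inj_on f D}"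
  \<comment> \<open>Injectivity of \<open>a\<close> makes the description unique; restricting to
    \<open>D\<close> makes \<open>g a\<close> extensional, as \<open>?F\<close> demands.\<close>
  define g where "g = (\<lambda>a :: 'a \<Rightarrow> 'b option. \<lambda>d\<in>D. THE k. a k = Some d)"
  define h where "h = (\<lambda>(f :: 'b \<Rightarrow> 'a) k. if k \<in> f ` D then Some (the_inv_into D f k) else None)"
  \<comment> \<open>\<open>h_iff\<close> and \<open>g_iff\<close> express that both maps transpose
    graphs; the bijection checks below rest on these two equivalences.\<close>
  have h_iff: "h f k = Some d \<longleftrightarrow> d \<in> D \<and> f d = k" if "f \<in> ?F" for f k d
    using that by (auto simp: h_def the_inv_into_f_f dest: inj_onD)
  have g_iff: "g a d = k \<longleftrightarrow> a k = Some d" if a: "a \<in> ?S" and d: "d \<in> D" for a d k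
  proof -
    obtain k' where k': "a k' = Some d"
      using a d by (auto simp: ran_def)
    have uniq: "k'' = k'" if "a k'' = Some d" for k''
      using a k' that inj_onD[of a "dom a" k'' k'] by (simp add: domIff)
    have "(THE k. a k = Some d) = k'"
      using k' uniq by (rule the_equality)
    then show ?thesis
      using d k' uniq[of k] by (auto simp: g_def)
  qed
  have "bij_betw g ?S ?F"
  proof (rule bij_betw_byWitness[where f' = h])
    show gS: "g ` ?S \<subseteq> ?F"
    proof (intro image_subsetI CollectI conjI)
      fix a assume a: "a \<in> ?S"
      have *: "a (g a d) = Some d" if "d \<in> D" for d
        using g_iff[OF a that] by blast
      then show "g a \<in> D \<rightarrow>\<^sub>E B"
        using a by (auto simp: PiE_def g_def)
      show "inj_on (g a) D"
        by (metis "*" inj_onI option.inject)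
    qed
    show hF: "h ` ?F \<subseteq> ?S"
    proof (intro image_subsetI CollectI conjI)
      fix f assume f: "f \<in> ?F"
      show "dom (h f) \<subseteq> B" "ran (h f) = D"
        using f by (auto simp: dom_def ran_def h_iff)
      show "inj_on (h f) (dom (h f))"
        by (rule inj_onI) (metis domD h_iff[OF f])
    qed
    show "\<forall>a\<in>?S. h (g a) = a"
    proof
      fix a assume a: "a \<in> ?S"
      have "d \<in> D" if "a k = Some d" for k d
        using a that by (auto intro: ranI)
      moreover have "g a \<in> ?F"
        using gS a by blast
      ultimately have "h (g a) k = Some d \<longleftrightarrow> a k = Some d" for k d
        using h_iff[of "g a" k d] g_iff[OF a, of d k] by blast
      then show "h (g a) = a"
        by (intro ext) (metis option.exhaust)
    qed
    show "\<forall>f\<in>?F. g (h f) = f"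
    proof
      fix f assume f: "f \<in> ?F"
      have "g (h f) d = f d" for d
      proof (cases "d \<in> D")
        case True
        then show ?thesis
          using g_iff[of "h f" d "f d"] h_iff[OF f, of "f d" d] imageI[OF f, of h, THEN hF[THEN subsetD]]
          by simp
      next
        case False
        then show ?thesis
          using f by (auto simp: g_def PiE_def extensional_def)
      qed
      then show "g (h f) = f" ..
    qed
  qed
  then have "card ?S = card ?F"
    by (rule bij_betw_same_card)
  also have "\<dots> = (\<Prod>i = 0..<card D. card B - i)"
    using card_inj_on_subset_funcset[OF assms(2,1), of D] by simp
  finally show ?thesis
    by (simp add: prod_falling_eq_choose_fact)
qed

section \<open>Probability of a child\<close>

text \<open>Total probability with a single contributing term. It serves
  \<open>child_prob_eq\<close> twice: a child reveals its outcome and its set of detected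
  objects.\<close>

lemma pmf_bind_single:
  assumes "\<And>y. y \<noteq> x \<Longrightarrow> pmf (f y) z = 0"
  shows "pmf (bind_pmf p f) z = pmf p x * pmf (f x) z"
proof -
  have "pmf (bind_pmf p f) z = (\<Sum>a\<in>{x}. pmf p a *\<^sub>R pmf (f a) z)"
    unfolding pmf_bind using assms by (intro integral_measure_pmf) auto
  then show ?thesis by simp
qed

lemma pmf_detected_pmf:
  assumes "finite A" "D \<subseteq> A" "0 \<le> q" "q \<le> 1"
  shows "pmf (detected_pmf q A) D = q ^ card D * (1 - q) ^ (card A - card D)"
proof -
  \<comment> \<open>Through \<open>Collect\<close>, the mass of the set \<open>D\<close> becomes the
    mass of its membership predicate under independent Bernoulli draws.\<close>
  have "inj (Collect :: (nat \<Rightarrow> bool) \<Rightarrow> nat set)"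
    by (auto intro: injI)
  from pmf_map_inj'[OF this, of "Pi_pmf A False (\<lambda>_. bernoulli_pmf q)" "\<lambda>k. k \<in> D"]
  have "pmf (detected_pmf q A) D = pmf (Pi_pmf A False (\<lambda>_. bernoulli_pmf q)) (\<lambda>k. k \<in> D)"
    by (simp add: detected_pmf_def)
  \<comment> \<open>Since \<open>D \<subseteq> A\<close>, the predicate takes the default value
    \<open>False\<close> off \<open>A\<close>; otherwise \<open>Pi_pmf\<close> would give it mass
    0.\<close>
  also have "\<dots> = (\<Prod>k\<in>A. pmf (bernoulli_pmf q) (k \<in> D))"
    using assms by (intro pmf_Pi') auto
  also have "\<dots> = (\<Prod>k\<in>A. if k \<in> D then q else 1 - q)"
    using assms by (intro prod.cong) auto
  also have "\<dots> = q ^ card D * (1 - q) ^ card (A - D)"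
  proof -
    have "A \<inter> D = D" "A \<inter> - D = A - D"
      using assms by auto
    then show ?thesis
      using assms by (simp add: prod.If_cases)
  qed
  finally show ?thesis
    using assms by (simp add: card_Diff_subset finite_subset)
qed

lemma finite_dying: "valid_model T \<Longrightarrow> i \<in> hyps T \<Longrightarrow> finite (dying T i)"
  unfolding valid_model_def by (meson finite_atLeastAtMost finite_subset)

text \<open>\<open>embed_pmf\<close> is sure to return the prescribed masses once they are
  nonnegative with total 1. The first comes from \<open>valid_model\<close>; the second holds
  because \<open>no_change_prob\<close> is what births and deaths leave of the total.\<close>

lemma pmf_outcome_pmf:
  assumes "valid_model T" "i \<in> hyps T" "c \<in> outcomes T i"
  shows "pmf (outcome_pmf T i) c =
    (case c of Birth l \<Rightarrow> birth_prob T | Death d \<Rightarrow> death_prob T | No_Change \<Rightarrow> no_change_prob T i)"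
proof -
  define p where "p = (\<lambda>c. case c of Birth l \<Rightarrow> birth_prob T | Death d \<Rightarrow> death_prob T
    | No_Change \<Rightarrow> no_change_prob T i)"
  have fin: "finite (dying T i)"
    using assms by (simp add: finite_dying)
  have nonneg: "0 \<le> p c" for c
    using assms by (auto simp: p_def valid_model_def split: outcome.split)
  have fin': "finite (outcomes T i)"
    using fin by (simp add: outcomes_def)
  have "sum p (outcomes T i) =
      sum p (Birth ` {1..num_births T}) + sum p (Death ` dying T i) + sum p {No_Change}"
    unfolding outcomes_def using fin
    by (subst sum.union_disjoint, simp, simp, blast)+ (rule refl)
  also have "\<dots> = 1"
    by (subst (1 2) sum.reindex) (auto simp: p_def inj_on_def no_change_prob_def)
  finally have "sum p (outcomes T i) = 1" .
  moreover have "(\<integral>\<^sup>+c. ennreal (if c \<in> outcomes T i then p c else 0) \<partial>count_space UNIV) =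
      (\<Sum>c\<in>outcomes T i. ennreal (p c))"
    by (subst nn_integral_count_space'[OF fin']) auto
  ultimately have "(\<integral>\<^sup>+c. ennreal (if c \<in> outcomes T i then p c else 0) \<partial>count_space UNIV) = 1"
    using nonneg by (simp add: sum_ennreal)
  then have "pmf (embed_pmf (\<lambda>c. if c \<in> outcomes T i then p c else 0)) c =
      (if c \<in> outcomes T i then p c else 0)"
    using nonneg by (intro pmf_embed_pmf) auto
  then show ?thesis
    using assms(3) unfolding outcome_pmf_def p_def by simp
qed

lemma child_prob_eq:
  assumes "valid_model T" "i \<in> hyps T" "(c, a) \<in> children T i"
  shows "child_prob T i (c, a) = pmf (outcome_pmf T i) c *
    assoc_prob (detect_prob T) (num_meas T) (card (objects_after (num_objs T i) c)) (card (ran a))"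
proof -
  define A where "A = objects_after (num_objs T i) c"
  define S where "S = (\<lambda>D. {a \<in> associations (num_meas T) D. ran a = D})"
  \<comment> \<open>The last stage of \<open>child_pmf\<close>, with outcome and detected set
    fixed.\<close>
  define h where "h = (\<lambda>c D. if S D = {} then return_pmf None
    else map_pmf (\<lambda>a. Some (c :: outcome, a)) (pmf_of_set (S D)))"
  have a: "a \<in> associations (num_meas T) A"
    using assms by (simp add: children_def objects_def A_def)
  have finA: "finite A"
    unfolding A_def by (cases c) auto
  have ranA: "ran a \<subseteq> A"
    using a by (simp add: associations_def)
  have finR: "finite (ran a)"
    using finA ranA finite_subset by blast
  have aS: "a \<in> S (ran a)"
    using a by (auto simp: S_def associations_def)
  have S_eq: "S D = {a. dom a \<subseteq> {1..num_meas T} \<and> ran a = D \<and> inj_on a (dom a)}" for D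
    by (auto simp: S_def associations_def)
  have cardS: "card (S (ran a)) = (num_meas T choose card (ran a)) * fact (card (ran a))"
    using card_injective_maps_onto[of "{1..num_meas T}" "ran a"] finR by (simp add: S_eq)
  \<comment> \<open>Finiteness makes \<open>pmf_of_set\<close> the uniform distribution. An infinite
    \<open>D\<close> cannot be the range of a map with domain inside
    \<open>{1..num_meas T}\<close>.\<close>
  have finS: "finite (S D)" for D
  proof (cases "finite D")
    case True
    then have "finite (\<Union>C\<in>Pow {1..num_meas T}. {f. dom f = C \<and> ran f \<subseteq> D})"
      by (intro finite_UN_I finite_set_of_finite_maps) (auto intro: finite_subset)
    then show ?thesis
      by (rule rev_finite_subset) (auto simp: S_eq)
  next
    case False
    then have "S D = {}"
      using finite_ran finite_subset[OF _ finite_atLeastAtMost] by (auto simp: S_eq)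
    then show ?thesis by simp
  qed
  \<comment> \<open>A sampled child displays both parameters: \<open>c'\<close> is its first
    component and \<open>D\<close> is the range of its association.\<close>
  have h_other: "pmf (h c' D) (Some (c, a)) = 0" if "c' \<noteq> c \<or> D \<noteq> ran a" for c' D
  proof (cases "S D = {}")
    case True
    then show ?thesis
      by (simp add: h_def)
  next
    case False
    then have "Some (c, a) \<notin> set_pmf (h c' D)"
      using that finS by (auto simp: h_def set_pmf_of_set S_eq)
    then show ?thesis
      by (simp add: set_pmf_iff)
  qed
  have h_val: "pmf (h c (ran a)) (Some (c, a)) = 1 / real (card (S (ran a)))"
  proof -
    have "pmf (map_pmf (\<lambda>a. Some (c, a)) (pmf_of_set (S (ran a)))) (Some (c, a)) =
        pmf (pmf_of_set (S (ran a))) a"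
      by (intro pmf_map_inj') (simp add: inj_on_def)
    \<comment> \<open>Hence \<open>h\<close> does not take the \<open>None\<close> branch
      here.\<close>
    moreover have "S (ran a) \<noteq> {}"
      using aS by blast
    ultimately show ?thesis
      using finS aS by (simp add: h_def)
  qed
  have "child_pmf T i = bind_pmf (outcome_pmf T i) (\<lambda>c.
      bind_pmf (detected_pmf (detect_prob T) (objects_after (num_objs T i) c)) (h c))"
    unfolding child_pmf_def h_def S_def Let_def ..
  then have "child_prob T i (c, a) = pmf (outcome_pmf T i) c *
      pmf (bind_pmf (detected_pmf (detect_prob T) A) (h c)) (Some (c, a))"
    unfolding child_prob_def A_def
    by (simp, intro pmf_bind_single) (simp add: pmf_bind h_other)
  also have "pmf (bind_pmf (detected_pmf (detect_prob T) A) (h c)) (Some (c, a)) =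
      pmf (detected_pmf (detect_prob T) A) (ran a) * pmf (h c (ran a)) (Some (c, a))"
    by (intro pmf_bind_single h_other) simp
  also have "\<dots> = assoc_prob (detect_prob T) (num_meas T) (card A) (card (ran a))"
    using assms(1) finA ranA
    by (simp add: h_val cardS pmf_detected_pmf assoc_prob_def valid_model_def)
  finally show ?thesis
    by (simp add: A_def)
qed

section \<open>Factorization of the predicted prior\<close>

lemma enn2real_prod: "enn2real (\<Prod>k\<in>A. f k) = (\<Prod>k\<in>A. enn2real (f k))"
  by (induction A rule: infinite_finite_induct) (simp_all add: enn2real_mult)

text \<open>
  For nonnegative factors no integrability is needed: \<open>enn2real\<close> is multiplicative and sends
  \<open>\<infinity>\<close> to 0, as the Bochner integral does with a non-integrable function.
\<close>

lemma (in product_sigma_finite) product_integral_prod_nonneg: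
  fixes f :: "'i \<Rightarrow> 'a \<Rightarrow> real"
  assumes "finite I" "\<And>k. k \<in> I \<Longrightarrow> f k \<in> borel_measurable (M k)" "\<And>k x. k \<in> I \<Longrightarrow> 0 \<le> f k x"
  shows "(\<integral>x. (\<Prod>k\<in>I. f k (x k)) \<partial>Pi\<^sub>M I M) = (\<Prod>k\<in>I. \<integral>x. f k x \<partial>M k)"
proof -
  have "(\<integral>x. (\<Prod>k\<in>I. f k (x k)) \<partial>Pi\<^sub>M I M) =
      enn2real (\<integral>\<^sup>+x. ennreal (\<Prod>k\<in>I. f k (x k)) \<partial>Pi\<^sub>M I M)"
    using assms
    by (intro integral_eq_nn_integral borel_measurable_prod AE_I2 prod_nonneg
        measurable_compose[OF measurable_component_singleton]) auto
  also have "(\<integral>\<^sup>+x. ennreal (\<Prod>k\<in>I. f k (x k)) \<partial>Pi\<^sub>M I M) =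
      (\<integral>\<^sup>+x. (\<Prod>k\<in>I. ennreal (f k (x k))) \<partial>Pi\<^sub>M I M)"
    using assms by (simp add: prod_ennreal)
  also have "\<dots> = (\<Prod>k\<in>I. \<integral>\<^sup>+x. ennreal (f k x) \<partial>M k)"
    using assms by (intro product_nn_integral_prod) auto
  also have "enn2real \<dots> = (\<Prod>k\<in>I. \<integral>x. f k x \<partial>M k)"
    unfolding enn2real_prod using assms
    by (intro prod.cong refl integral_eq_nn_integral[symmetric]) auto
  finally show ?thesis .
qed

text \<open>The prior pdfs of the objects outside the set \<open>A\<close> of survivors integrate to one.\<close>

lemma state_integral_survivors:
  assumes "valid_model T" "i \<in> hyps T" "A \<subseteq> {1..num_objs T i}"
  shows "state_integral {1..num_objs T i}
      (\<lambda>X'. (\<Prod>k\<in>A. trans_pdf T i k (the (X k)) (the (X' k))) * prior_pdf T i X') =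
    (\<Prod>k\<in>A. pred_obj_pdf T i k (the (X k)))"
proof -
  define I where "I = {1..num_objs T i}"
  \<comment> \<open>Padding with 1 outside \<open>A\<close> merges the transition and prior products
    into one product over all labels in \<open>I\<close>.\<close>
  define f where "f = (\<lambda>k x'. (if k \<in> A then trans_pdf T i k (the (X k)) x' else 1) * obj_pdf T i k x')"
  have A: "A \<subseteq> I" "finite I" "A = I \<inter> A"
    using assms(3) by (auto simp: I_def)
  interpret product_sigma_finite "\<lambda>_ :: nat. lborel :: (real ^ 'b) measure"
    by standard
  have obj: "is_pdf (obj_pdf T i k)" if "k \<in> I" for k
    using assms that by (simp add: valid_model_def I_def)
  have trans: "trans_pdf T i k x \<in> borel_measurable borel" "0 \<le> trans_pdf T i k x x'"
    if "k \<in> I" for k x x'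
  proof -
    have "(\<lambda>(x, x'). trans_pdf T i k x x') \<in> borel_measurable (borel \<Otimes>\<^sub>M borel)"
      and pdf: "is_pdf (\<lambda>x. trans_pdf T i k x x')"
      using assms that by (auto simp: valid_model_def I_def)
    \<comment> \<open>Integration runs over the previous state, so the section at a fixed current
      state \<open>x\<close> is taken.\<close>
    from measurable_Pair2[OF this(1), of x] show "trans_pdf T i k x \<in> borel_measurable borel"
      by simp
    show "0 \<le> trans_pdf T i k x x'"
      using pdf by (simp add: is_pdf_def)
  qed
  have meas: "f k \<in> borel_measurable lborel" if "k \<in> I" for k
    using obj[OF that] trans[OF that]
    by (auto simp: f_def is_pdf_def intro!: borel_measurable_times)
  have nonneg: "0 \<le> f k x" if "k \<in> I" for k x
    using obj[OF that] trans[OF that] by (auto simp: f_def is_pdf_def)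
  have "(\<Prod>k\<in>A. trans_pdf T i k (the (X k)) (x k)) * (\<Prod>k\<in>I. obj_pdf T i k (x k)) =
      (\<Prod>k\<in>I. f k (x k))" for x
  proof -
    have "(\<Prod>k\<in>A. trans_pdf T i k (the (X k)) (x k)) =
        (\<Prod>k\<in>I. if k \<in> A then trans_pdf T i k (the (X k)) (x k) else 1)"
      using A(2) by (subst A(3)) (rule prod.inter_restrict)
    then show ?thesis
      by (simp add: f_def prod.distrib)
  qed
  \<comment> \<open>Labels in \<open>A\<close> lie in \<open>I\<close>, so \<open>the\<close> is
    only applied to \<open>Some\<close> values.\<close>
  moreover have "(\<Prod>k\<in>A. trans_pdf T i k (the (X k)) (the (if k \<in> I then Some (x k) else None))) =
      (\<Prod>k\<in>A. trans_pdf T i k (the (X k)) (x k))" for x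
    using A(1) by (intro prod.cong) auto
  ultimately have "state_integral I
      (\<lambda>X'. (\<Prod>k\<in>A. trans_pdf T i k (the (X k)) (the (X' k))) * prior_pdf T i X') =
      (\<integral>x. (\<Prod>k\<in>I. f k (x k)) \<partial>Pi\<^sub>M I (\<lambda>_. lborel))"
    unfolding state_integral_def prior_pdf_def I_def[symmetric] by simp
  also have "\<dots> = (\<Prod>k\<in>I. \<integral>x. f k x \<partial>lborel)"
    using A(2) meas nonneg by (rule product_integral_prod_nonneg)
  also have "\<dots> = (\<Prod>k\<in>I. if k \<in> A then pred_obj_pdf T i k (the (X k)) else 1)"
    using obj by (intro prod.cong) (auto simp: f_def pred_obj_pdf_def is_pdf_def)
  also have "\<dots> = (\<Prod>k\<in>A. pred_obj_pdf T i k (the (X k)))"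
    using A(2) by (subst (2) A(3)) (rule prod.inter_restrict[symmetric])
  finally show ?thesis
    by (simp add: I_def)
qed

section \<open>Bayes' rule and the update equation\<close>

lemma state_integral_mult_right: "state_integral A (\<lambda>X. f X * c) = state_integral A f * c"
  by (simp add: state_integral_def)

text \<open>The factor \<open>child_weight T i j\<close> does not depend on the continuous state and
  leaves each integral.\<close>

lemma bayes_denom_eq:
  "bayes_denom T = (\<Sum>(i, j)\<in>(SIGMA i:hyps T. children T i). child_lik T i j * child_weight T i j)"
  unfolding bayes_denom_def child_lik_def child_weight_def pred_joint_def
  by (intro sum.cong refl) (simp add: state_integral_mult_right split_beta flip: mult.assoc)

theorem proposition2:
  fixes T :: "('h, 'n::finite, 'z) tracking_model" and i :: 'h and M :: nat
  assumes "valid_model T" and "i \<in> hyps T" and "num_objs T i = M"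
    and "bayes_denom T > 0"
  shows
    "(\<forall>j X. j \<in> children T i \<longrightarrow> dom X = objects T i j \<longrightarrow> child_lik T i j > 0 \<longrightarrow>
       posterior T i j X =
         likelihood T j X * pred_prior T i j X /
           state_integral (objects T i j) (\<lambda>X'. likelihood T j X' * pred_prior T i j X') *
         (child_lik T i j * child_weight T i j /
           (\<Sum>(i', j')\<in>(SIGMA i':hyps T. children T i'). child_lik T i' j' * child_weight T i' j'))) \<and>
     (\<forall>j k. j \<in> B_hyps T i (M + 1) k \<longrightarrow>
       child_prob T i j = birth_prob T * assoc_prob (detect_prob T) (num_meas T) (M + 1) k) \<and>
     (\<forall>j k. j \<in> B_hyps T i M k \<longrightarrow>
       child_prob T i j =
         (1 - real (num_births T) * birth_prob T - real (card (dying T i)) * death_prob T) *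
         assoc_prob (detect_prob T) (num_meas T) M k) \<and>
     (\<forall>j k. 1 \<le> M \<longrightarrow> j \<in> B_hyps T i (M - 1) k \<longrightarrow>
       child_prob T i j = death_prob T * assoc_prob (detect_prob T) (num_meas T) (M - 1) k) \<and>
     (\<forall>d a X. (Death d, a) \<in> children T i \<longrightarrow> dom X = {1..M} - {d} \<longrightarrow>
       pred_prior T i (Death d, a) X = (\<Prod>k\<in>{1..M} - {d}. pred_obj_pdf T i k (the (X k)))) \<and>
     (\<forall>l a X. (Birth l, a) \<in> children T i \<longrightarrow> dom X = {1..M + 1} \<longrightarrow>
       pred_prior T i (Birth l, a) X =
         (\<Prod>k=1..M. pred_obj_pdf T i k (the (X k))) * birth_pdf T l (the (X (M + 1)))) \<and>
     (\<forall>a X. (No_Change, a) \<in> children T i \<longrightarrow> dom X = {1..M} \<longrightarrow>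
       pred_prior T i (No_Change, a) X = (\<Prod>k=1..M. pred_obj_pdf T i k (the (X k))))"
proof (intro conjI allI impI)
  note [simp] = assms(3)
  have "dying T i \<subseteq> {1..num_objs T i}"
    using assms(1,2) unfolding valid_model_def by blast
  then have dying: "dying T i \<subseteq> {1..M}"
    by simp
  note prob = child_prob_eq[OF assms(1,2)] pmf_outcome_pmf[OF assms(1,2)]
  {
    fix j X assume "0 < child_lik T i j"
    then show "posterior T i j X =
         likelihood T j X * pred_prior T i j X /
           state_integral (objects T i j) (\<lambda>X'. likelihood T j X' * pred_prior T i j X') *
         (child_lik T i j * child_weight T i j /
           (\<Sum>(i', j')\<in>(SIGMA i':hyps T. children T i'). child_lik T i' j' * child_weight T i' j'))"
      \<comment> \<open>Once \<open>child_lik\<close> is folded back in, the first denominator is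
        the factor inserted in the second numerator; its positivity lets the two cancel.\<close>
      unfolding posterior_def bayes_denom_eq child_lik_def[of T i j, symmetric]
      by (simp add: pred_joint_def child_weight_def mult.assoc)
  next
    fix j k assume "j \<in> B_hyps T i (M + 1) k"
    moreover obtain c a where j: "j = (c, a)" by fastforce
    ultimately have c: "(c, a) \<in> children T i" "card (objects_after M c) = M + 1" "card (ran a) = k"
      by (auto simp: B_hyps_def objects_def)
    have "card ({1..M} - {d}) \<noteq> M + 1" for d
      using card_mono[of "{1..M}" "{1..M} - {d}"] by simp
    with c(2) obtain l where "c = Birth l"
      by (cases c) auto
    with c show "child_prob T i j =
        birth_prob T * assoc_prob (detect_prob T) (num_meas T) (M + 1) k"
      by (auto simp: j prob children_def)
  next
    fix j k assume "j \<in> B_hyps T i M k"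
    moreover obtain c a where j: "j = (c, a)" by fastforce
    ultimately have c: "(c, a) \<in> children T i" "card (objects_after M c) = M" "card (ran a) = k"
      by (auto simp: B_hyps_def objects_def)
    \<comment> \<open>Removing \<open>d\<close> lowers the cardinality only because \<open>d\<close>
      is a label of an existing object; this is where \<open>dying\<close> enters.\<close>
    have False if d: "c = Death d" for d
    proof -
      have "d \<in> {1..M}"
        using c(1) d dying by (auto simp: children_def outcomes_def)
      then show False
        using c(2) d by (cases M) (simp_all add: card_Diff_singleton)
    qed
    with c(2) have "c = No_Change"
      by (cases c) auto
    with c show "child_prob T i j =
        (1 - real (num_births T) * birth_prob T - real (card (dying T i)) * death_prob T) *
        assoc_prob (detect_prob T) (num_meas T) M k"
      by (auto simp: j prob children_def no_change_prob_def)
  next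
    fix j k assume M: "1 \<le> M" and "j \<in> B_hyps T i (M - 1) k"
    moreover obtain c a where j: "j = (c, a)" by fastforce
    ultimately have c: "(c, a) \<in> children T i" "card (objects_after M c) = M - 1" "card (ran a) = k"
      by (auto simp: B_hyps_def objects_def)
    \<comment> \<open>For \<open>M = 0\<close>, truncated subtraction would give
      \<open>M - 1 = M\<close> and admit \<open>No_Change\<close>; \<open>1 \<le> M\<close> excludes
      this.\<close>
    with M obtain d where "c = Death d"
      by (cases c) auto
    with c show "child_prob T i j =
        death_prob T * assoc_prob (detect_prob T) (num_meas T) (M - 1) k"
      by (auto simp: j prob children_def)
  next
    fix d a and X :: "nat \<rightharpoonup> real ^ 'n" assume "dom X = {1..M} - {d}"
    \<comment> \<open>The dead object is null in \<open>X\<close>, so \<open>null_mass\<close>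
      contributes the factor 1.\<close>
    then have "X d = None"
      by auto
    then show "pred_prior T i (Death d, a) X = (\<Prod>k\<in>{1..M} - {d}. pred_obj_pdf T i k (the (X k)))"
      using state_integral_survivors[OF assms(1,2), of "{1..M} - {d}" X]
      by (auto simp: pred_prior_def multi_trans_pdf_def null_mass_def)
  next
    fix l a and X :: "nat \<rightharpoonup> real ^ 'n"
    \<comment> \<open>The birth density is constant in the previous state \<open>X'\<close>; moved
      to the right, it can be taken out of the integral.\<close>
    have "pred_prior T i (Birth l, a) X = state_integral {1..M} (\<lambda>X'.
        (\<Prod>k=1..M. trans_pdf T i k (the (X k)) (the (X' k))) * prior_pdf T i X' *
        birth_pdf T l (the (X (M + 1))))"
      by (simp add: pred_prior_def multi_trans_pdf_def mult_ac)
    then show "pred_prior T i (Birth l, a) X =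
        (\<Prod>k=1..M. pred_obj_pdf T i k (the (X k))) * birth_pdf T l (the (X (M + 1)))"
      using state_integral_survivors[OF assms(1,2), of "{1..M}" X]
      by (simp add: state_integral_mult_right)
  next
    fix a and X :: "nat \<rightharpoonup> real ^ 'n"
    show "pred_prior T i (No_Change, a) X = (\<Prod>k=1..M. pred_obj_pdf T i k (the (X k)))"
      using state_integral_survivors[OF assms(1,2), of "{1..M}" X]
      by (simp add: pred_prior_def multi_trans_pdf_def)
  }
qed

end
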